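(* Let $M=M_1\oplus M_2$ be a right $R$-module, where $M_1$ and $M_2$ are CLS-modules. If $M_1$ and $M_2$ are relatively ojective, then $M$ is a CLS-module.
   Context: $R$ is an associative ring with identity and all modules are unital right $R$-modules. For submodules $S\leq M$, $S$ is essential in $M$ ($S\leq_e M$) if for any $T\leq M$, $S\cap T=0$ implies $T=0$. The singular submodule is $Z(M)=\{m\in M : mI=0 \text{ for some essential right ideal } I \text{ of } R\}$, and $M$ is nonsingular if $Z(M)=0$. A submodule $N\leq M$ is $\mathscr{S}$-closed in $M$ if $M/N$ is nonsingular. $M$ is a CLS-module if every $\mathscr{S}$-closed submodule of $M$ is a direct summand of $M$. A complement of a submodule $B$ in $M$ is a submodule $C\leq M$ maximal with respect to $C\cap B=0$. For modules $A,B$, $B$ is $A$-ojective if for any complement $C$ of $B$ in $A\oplus B$, $A\oplus B$ decomposes as $A\oplus B=C\oplus A'\oplus B'$ with $A'\leq A$ and $B'\leq B$. $A$ and $B$ are relatively ojective if $A$ is $B$-ojective and $B$ is $A$-ojective. *)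

theory Defs
  imports "HOL-Algebra.Module" "HOL-Algebra.AbelCoset"
begin

text \<open>
  The library's \<^locale>\<open>module\<close> is restricted to commutative rings and left scalars, so unital right
  modules over an arbitrary ring are set up here.  As for the library's modules, the record
  extends the ring record only to reuse its additive structure; its multiplication and unit
  are never referred to.
\<close>

record ('a, 'm) rmodule = "'m ring" +
  rsmult :: "'m \<Rightarrow> 'a \<Rightarrow> 'm" (infixl \<open>\<odot>\<^sub>r\<index>\<close> 70)

locale right_module = R?: ring R + M?: abelian_group M
  for R :: "('a, 'r) ring_scheme" (structure) and M :: "('a, 'm, 'z) rmodule_scheme" (structure) +
  assumes rsmult_closed:
      "\<lbrakk>x \<in> carrier M; a \<in> carrier R\<rbrakk> \<Longrightarrow> x \<odot>\<^sub>r\<^bsub>M\<^esub> a \<in> carrier M"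
    and rsmult_add_left:
      "\<lbrakk>x \<in> carrier M; y \<in> carrier M; a \<in> carrier R\<rbrakk> \<Longrightarrow>
       (x \<oplus>\<^bsub>M\<^esub> y) \<odot>\<^sub>r\<^bsub>M\<^esub> a = x \<odot>\<^sub>r\<^bsub>M\<^esub> a \<oplus>\<^bsub>M\<^esub> y \<odot>\<^sub>r\<^bsub>M\<^esub> a"
    and rsmult_add_right:
      "\<lbrakk>x \<in> carrier M; a \<in> carrier R; b \<in> carrier R\<rbrakk> \<Longrightarrow>
       x \<odot>\<^sub>r\<^bsub>M\<^esub> (a \<oplus>\<^bsub>R\<^esub> b) = x \<odot>\<^sub>r\<^bsub>M\<^esub> a \<oplus>\<^bsub>M\<^esub> x \<odot>\<^sub>r\<^bsub>M\<^esub> b"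
    and rsmult_assoc:
      "\<lbrakk>x \<in> carrier M; a \<in> carrier R; b \<in> carrier R\<rbrakk> \<Longrightarrow>
       x \<odot>\<^sub>r\<^bsub>M\<^esub> (a \<otimes>\<^bsub>R\<^esub> b) = (x \<odot>\<^sub>r\<^bsub>M\<^esub> a) \<odot>\<^sub>r\<^bsub>M\<^esub> b"
    and rsmult_one:
      "x \<in> carrier M \<Longrightarrow> x \<odot>\<^sub>r\<^bsub>M\<^esub> \<one>\<^bsub>R\<^esub> = x"

definition right_submodule ::
    "('a, 'r) ring_scheme \<Rightarrow> ('a, 'm, 'z) rmodule_scheme \<Rightarrow> 'm set \<Rightarrow> bool" where
  "right_submodule R M N \<longleftrightarrow>
     additive_subgroup N M \<and> (\<forall>x\<in>N. \<forall>a\<in>carrier R. x \<odot>\<^sub>r\<^bsub>M\<^esub> a \<in> N)"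

text \<open>A submodule \<open>N\<close> of \<open>M\<close>, viewed as a module in its own right.\<close>

abbreviation restrict_module ::
    "('a, 'm, 'z) rmodule_scheme \<Rightarrow> 'm set \<Rightarrow> ('a, 'm, 'z) rmodule_scheme" where
  "restrict_module M N \<equiv> M\<lparr>carrier := N\<rparr>"

definition regular_module :: "('a, 'r) ring_scheme \<Rightarrow> ('a, 'a) rmodule" where
  "regular_module R =
     \<lparr>carrier = carrier R, mult = mult R, one = one R, zero = zero R, add = add R,
      rsmult = mult R\<rparr>"

text \<open>
  The union below equals the single coset \<open>N + x a\<close> for any representative \<open>x\<close> of \<open>X\<close>.
\<close>

definition quotient_module ::
    "('a, 'm, 'z) rmodule_scheme \<Rightarrow> 'm set \<Rightarrow> ('a, 'm set) rmodule" where
  "quotient_module M N =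
     \<lparr>carrier = a_rcosets\<^bsub>M\<^esub> N, mult = undefined, one = undefined, zero = N, add = set_add M,
      rsmult = (\<lambda>X a. \<Union>x\<in>X. N +>\<^bsub>M\<^esub> (x \<odot>\<^sub>r\<^bsub>M\<^esub> a))\<rparr>"

definition direct_sum_module ::
    "('a, 'm, 'y) rmodule_scheme \<Rightarrow> ('a, 'n, 'z) rmodule_scheme \<Rightarrow> ('a, 'm \<times> 'n) rmodule" where
  "direct_sum_module A B =
     \<lparr>carrier = carrier A \<times> carrier B, mult = undefined, one = undefined,
      zero = (\<zero>\<^bsub>A\<^esub>, \<zero>\<^bsub>B\<^esub>),
      add = (\<lambda>(x, y) (x', y'). (x \<oplus>\<^bsub>A\<^esub> x', y \<oplus>\<^bsub>B\<^esub> y')),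
      rsmult = (\<lambda>(x, y) a. (x \<odot>\<^sub>r\<^bsub>A\<^esub> a, y \<odot>\<^sub>r\<^bsub>B\<^esub> a))\<rparr>"

text \<open>\<open>S = N \<oplus> K\<close> for subsets (in practice submodules) of \<open>M\<close>.\<close>

definition internal_direct_sum ::
    "('a, 'm, 'z) rmodule_scheme \<Rightarrow> 'm set \<Rightarrow> 'm set \<Rightarrow> 'm set \<Rightarrow> bool" where
  "internal_direct_sum M S N K \<longleftrightarrow> S = N <+>\<^bsub>M\<^esub> K \<and> N \<inter> K = {\<zero>\<^bsub>M\<^esub>}"

definition direct_summand ::
    "('a, 'r) ring_scheme \<Rightarrow> ('a, 'm, 'z) rmodule_scheme \<Rightarrow> 'm set \<Rightarrow> bool" where
  "direct_summand R M N \<longleftrightarrow>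
     right_submodule R M N \<and>
     (\<exists>K. right_submodule R M K \<and> internal_direct_sum M (carrier M) N K)"

definition essential_submodule ::
    "('a, 'r) ring_scheme \<Rightarrow> ('a, 'm, 'z) rmodule_scheme \<Rightarrow> 'm set \<Rightarrow> bool" where
  "essential_submodule R M S \<longleftrightarrow>
     right_submodule R M S \<and>
     (\<forall>T. right_submodule R M T \<and> S \<inter> T = {\<zero>\<^bsub>M\<^esub>} \<longrightarrow> T = {\<zero>\<^bsub>M\<^esub>})"

abbreviation essential_right_ideal :: "('a, 'r) ring_scheme \<Rightarrow> 'a set \<Rightarrow> bool" where
  "essential_right_ideal R I \<equiv> essential_submodule R (regular_module R) I"

definition singular_submodule ::
    "('a, 'r) ring_scheme \<Rightarrow> ('a, 'm, 'z) rmodule_scheme \<Rightarrow> 'm set" where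
  "singular_submodule R M =
     {m \<in> carrier M. \<exists>I. essential_right_ideal R I \<and> (\<forall>a\<in>I. m \<odot>\<^sub>r\<^bsub>M\<^esub> a = \<zero>\<^bsub>M\<^esub>)}"

definition nonsingular :: "('a, 'r) ring_scheme \<Rightarrow> ('a, 'm, 'z) rmodule_scheme \<Rightarrow> bool" where
  "nonsingular R M \<longleftrightarrow> singular_submodule R M = {\<zero>\<^bsub>M\<^esub>}"

definition S_closed ::
    "('a, 'r) ring_scheme \<Rightarrow> ('a, 'm, 'z) rmodule_scheme \<Rightarrow> 'm set \<Rightarrow> bool" where
  "S_closed R M N \<longleftrightarrow> right_submodule R M N \<and> nonsingular R (quotient_module M N)"

definition CLS_module :: "('a, 'r) ring_scheme \<Rightarrow> ('a, 'm, 'z) rmodule_scheme \<Rightarrow> bool" where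
  "CLS_module R M \<longleftrightarrow> right_module R M \<and> (\<forall>N. S_closed R M N \<longrightarrow> direct_summand R M N)"

definition complement_of ::
    "('a, 'r) ring_scheme \<Rightarrow> ('a, 'm, 'z) rmodule_scheme \<Rightarrow> 'm set \<Rightarrow> 'm set \<Rightarrow> bool" where
  "complement_of R M B C \<longleftrightarrow>
     right_submodule R M C \<and> C \<inter> B = {\<zero>\<^bsub>M\<^esub>} \<and>
     (\<forall>D. right_submodule R M D \<and> D \<inter> B = {\<zero>\<^bsub>M\<^esub>} \<and> C \<subseteq> D \<longrightarrow> D = C)"

text \<open>
  \<open>ojective R A B\<close> reads ``\<open>B\<close> is \<open>A\<close>-ojective''.  Submodules \<open>A'\<close> of \<open>A\<close> and \<open>B'\<close> of \<open>B\<close>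
  are identified with \<open>A' \<times> 0\<close> and \<open>0 \<times> B'\<close> in \<open>A \<oplus> B\<close>, and the decomposition into
  three summands is written as \<open>(C \<oplus> A') \<oplus> B'\<close>.
\<close>

definition ojective ::
    "('a, 'r) ring_scheme \<Rightarrow> ('a, 'm, 'y) rmodule_scheme \<Rightarrow> ('a, 'n, 'z) rmodule_scheme \<Rightarrow> bool"
  where
  "ojective R A B \<longleftrightarrow>
     (let P = direct_sum_module A B in
      \<forall>C. complement_of R P ({\<zero>\<^bsub>A\<^esub>} \<times> carrier B) C \<longrightarrow>
        (\<exists>A' B'. right_submodule R A A' \<and> right_submodule R B B' \<and>
          (let D = C <+>\<^bsub>P\<^esub> (A' \<times> {\<zero>\<^bsub>B\<^esub>}) in
           internal_direct_sum P D C (A' \<times> {\<zero>\<^bsub>B\<^esub>}) \<and>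
           internal_direct_sum P (carrier P) D ({\<zero>\<^bsub>A\<^esub>} \<times> B'))))"

definition relatively_ojective ::
    "('a, 'r) ring_scheme \<Rightarrow> ('a, 'm, 'y) rmodule_scheme \<Rightarrow> ('a, 'n, 'z) rmodule_scheme \<Rightarrow> bool"
  where
  "relatively_ojective R A B \<longleftrightarrow> ojective R B A \<and> ojective R A B"

end

theory Submission
  imports Defs
begin

text \<open>
  Let \<open>N\<close> be a submodule of \<open>M\<close> with \<open>M/N\<close> nonsingular.  Everything rests on one way of using this:
  an element \<open>m\<close> lies in \<open>N\<close> as soon as \<open>m I \<subseteq> N\<close> for some essential right ideal \<open>I\<close>
  (\<open>S_closed_iff\<close>).  In particular \<open>N\<close> contains all singular elements of \<open>M\<close>, and
  \<open>N \<inter> M\<^sub>2\<close> inherits the property inside \<open>M\<^sub>2\<close>.  So \<open>M\<^sub>2 = (N \<inter> M\<^sub>2) \<oplus> E\<^sub>2\<close> as \<open>M\<^sub>2\<close>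
  is CLS, and \<open>N = (N \<inter> M\<^sub>2) \<oplus> K\<close> with \<open>K = N \<inter> (M\<^sub>1 \<oplus> E\<^sub>2)\<close>, which meets \<open>M\<^sub>2\<close> in \<open>0\<close>.

  The idea is to place \<open>K\<close> in a complement of \<open>M\<^sub>2\<close> of which it is a summand; ojectivity then splits
  that complement off \<open>M\<close>.  Let \<open>X\<close> be the projection of \<open>K\<close> to \<open>M\<^sub>1\<close>, and let \<open>L\<close> consist of the
  \<open>x\<close> in \<open>M\<^sub>1\<close> with \<open>x I \<subseteq> X\<close> for some essential right ideal \<open>I\<close>.  Since \<open>X\<close> contains the
  singular elements of \<open>M\<^sub>1\<close>, the quotient \<open>M\<^sub>1/L\<close> is nonsingular
  (\<open>S_closed_singular_closure\<close>), so \<open>M\<^sub>1 = L \<oplus> E\<^sub>1\<close> as \<open>M\<^sub>1\<close> is CLS.  Then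
  \<open>C = K \<oplus> E\<^sub>1\<close> is a complement of \<open>M\<^sub>2\<close>: if \<open>D \<supseteq> C\<close> meets \<open>M\<^sub>2\<close> in \<open>0\<close> and
  \<open>d \<in> D\<close> has its \<open>M\<^sub>1\<close>-component in \<open>L\<close>, then \<open>d I \<subseteq> K\<close> for an essential right ideal \<open>I\<close>,
  so \<open>d \<in> N\<close> and even \<open>d \<in> K\<close>.

  Ojectivity now yields \<open>M = C \<oplus> A' \<oplus> B'\<close>
  (\<open>ojective_complement_decomposition\<close>).  Hence \<open>K\<close> is a summand of \<open>M\<close>, by modularity also of
  \<open>M\<^sub>1 \<oplus> E\<^sub>2\<close>, and since \<open>M = (N \<inter> M\<^sub>2) \<oplus> (M\<^sub>1 \<oplus> E\<^sub>2)\<close>, \<open>N\<close> is a summand of \<open>M\<close>.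
\<close>

section \<open>Submodules and direct sums\<close>

lemma mem_set_add_iff: "x \<in> A <+>\<^bsub>G\<^esub> B \<longleftrightarrow> (\<exists>a\<in>A. \<exists>b\<in>B. x = a \<oplus>\<^bsub>G\<^esub> b)"
  by (auto simp: set_add_def')

context right_module
begin

lemma rsmult_zero_right: "x \<in> carrier M \<Longrightarrow> x \<odot>\<^sub>r\<^bsub>M\<^esub> \<zero>\<^bsub>R\<^esub> = \<zero>\<^bsub>M\<^esub>"
  using rsmult_add_right[of x "\<zero>\<^bsub>R\<^esub>" "\<zero>\<^bsub>R\<^esub>"] by (simp add: rsmult_closed)

lemma rsmult_zero_left: "a \<in> carrier R \<Longrightarrow> \<zero>\<^bsub>M\<^esub> \<odot>\<^sub>r\<^bsub>M\<^esub> a = \<zero>\<^bsub>M\<^esub>"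
  using rsmult_add_left[of "\<zero>\<^bsub>M\<^esub>" "\<zero>\<^bsub>M\<^esub>" a] by (simp add: rsmult_closed)

lemma rsmult_minus_one:
  assumes "x \<in> carrier M"
  shows "x \<odot>\<^sub>r\<^bsub>M\<^esub> (\<ominus>\<^bsub>R\<^esub> \<one>\<^bsub>R\<^esub>) = \<ominus>\<^bsub>M\<^esub> x"
proof -
  have "x \<odot>\<^sub>r\<^bsub>M\<^esub> (\<ominus>\<^bsub>R\<^esub> \<one>\<^bsub>R\<^esub>) \<oplus>\<^bsub>M\<^esub> x = x \<odot>\<^sub>r\<^bsub>M\<^esub> (\<ominus>\<^bsub>R\<^esub> \<one>\<^bsub>R\<^esub> \<oplus>\<^bsub>R\<^esub> \<one>\<^bsub>R\<^esub>)"
    using assms by (simp add: rsmult_add_right rsmult_one)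
  also have "\<dots> = \<zero>\<^bsub>M\<^esub>"
    using assms by (simp add: R.l_neg rsmult_zero_right)
  finally show ?thesis
    using assms by (intro M.minus_equality[symmetric]) (simp_all add: rsmult_closed)
qed

text \<open>
  Closure under negatives comes for free, as \<open>- x = x (- 1)\<close>.
\<close>

lemma right_submodule_iff:
  "right_submodule R M N \<longleftrightarrow>
     N \<subseteq> carrier M \<and> \<zero>\<^bsub>M\<^esub> \<in> N \<and> (\<forall>x\<in>N. \<forall>y\<in>N. x \<oplus>\<^bsub>M\<^esub> y \<in> N) \<and>
     (\<forall>x\<in>N. \<forall>a\<in>carrier R. x \<odot>\<^sub>r\<^bsub>M\<^esub> a \<in> N)" (is "?l \<longleftrightarrow> ?r")
proof
  assume ?l
  then show ?r
    unfolding right_submodule_def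
    by (auto dest: additive_subgroup.a_subset additive_subgroup.zero_closed
        additive_subgroup.a_closed)
next
  assume r: ?r
  have "\<ominus>\<^bsub>M\<^esub> x \<in> N" if "x \<in> N" for x
    using r that by (subst rsmult_minus_one[symmetric]) auto
  then have "additive_subgroup N M"
    using r by (auto intro!: additive_subgroupI M.add.subgroupI simp: a_inv_def)
  with r show ?l
    by (auto simp: right_submodule_def)
qed

lemma right_submoduleD:
  assumes "right_submodule R M N"
  shows "N \<subseteq> carrier M" "\<zero>\<^bsub>M\<^esub> \<in> N"
    "\<And>x y. \<lbrakk>x \<in> N; y \<in> N\<rbrakk> \<Longrightarrow> x \<oplus>\<^bsub>M\<^esub> y \<in> N"
    "\<And>x a. \<lbrakk>x \<in> N; a \<in> carrier R\<rbrakk> \<Longrightarrow> x \<odot>\<^sub>r\<^bsub>M\<^esub> a \<in> N"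
  using assms unfolding right_submodule_iff by blast+

lemma right_submodule_minus:
  assumes "right_submodule R M N" "x \<in> N" "y \<in> N"
  shows "x \<ominus>\<^bsub>M\<^esub> y \<in> N"
proof -
  have "y \<in> carrier M" and "y \<odot>\<^sub>r\<^bsub>M\<^esub> (\<ominus>\<^bsub>R\<^esub> \<one>\<^bsub>R\<^esub>) \<in> N"
    using assms unfolding right_submodule_iff by auto
  then have "\<ominus>\<^bsub>M\<^esub> y \<in> N"
    by (simp only: rsmult_minus_one)
  with assms(1,2) show ?thesis
    unfolding right_submodule_iff a_minus_def by blast
qed

lemma minus_add_cancel:
  assumes "x \<in> carrier M" "y \<in> carrier M"
  shows "(x \<oplus>\<^bsub>M\<^esub> y) \<ominus>\<^bsub>M\<^esub> y = x" "(x \<oplus>\<^bsub>M\<^esub> y) \<ominus>\<^bsub>M\<^esub> x = y" "x \<oplus>\<^bsub>M\<^esub> (y \<ominus>\<^bsub>M\<^esub> x) = y"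
    "(y \<ominus>\<^bsub>M\<^esub> x) \<oplus>\<^bsub>M\<^esub> x = y"
proof -
  show "(x \<oplus>\<^bsub>M\<^esub> y) \<ominus>\<^bsub>M\<^esub> y = x" "(y \<ominus>\<^bsub>M\<^esub> x) \<oplus>\<^bsub>M\<^esub> x = y"
    using assms by (simp_all add: a_minus_def M.a_assoc M.r_neg M.l_neg)
  show "(x \<oplus>\<^bsub>M\<^esub> y) \<ominus>\<^bsub>M\<^esub> x = y"
    using assms by (simp add: a_minus_def M.a_comm[of x y] M.a_assoc M.r_neg)
  show "x \<oplus>\<^bsub>M\<^esub> (y \<ominus>\<^bsub>M\<^esub> x) = y"
    using assms M.a_lcomm[of x y "\<ominus>\<^bsub>M\<^esub> x"] by (simp add: a_minus_def M.r_neg)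
qed

lemma right_submodule_add_cancel:
  assumes N: "right_submodule R M N" and "x \<oplus>\<^bsub>M\<^esub> y \<in> N" "x \<in> carrier M" "y \<in> carrier M"
  shows "x \<in> N \<longleftrightarrow> y \<in> N"
  using right_submodule_minus[OF N] minus_add_cancel(1,2) assms by metis

lemma right_submodule_Int:
  "\<lbrakk>right_submodule R M N; right_submodule R M K\<rbrakk> \<Longrightarrow> right_submodule R M (N \<inter> K)"
  unfolding right_submodule_iff by blast

lemma right_submodule_set_add:
  assumes N: "right_submodule R M N" and K: "right_submodule R M K"
  shows "right_submodule R M (N <+>\<^bsub>M\<^esub> K)"
proof -
  note c = subsetD[OF right_submoduleD(1)[OF N]] subsetD[OF right_submoduleD(1)[OF K]]
  have "x \<oplus>\<^bsub>M\<^esub> y \<in> N <+>\<^bsub>M\<^esub> K" if xy: "x \<in> N <+>\<^bsub>M\<^esub> K" "y \<in> N <+>\<^bsub>M\<^esub> K" for x y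
  proof -
    obtain n k n' k' where h: "n \<in> N" "k \<in> K" "n' \<in> N" "k' \<in> K"
        "x = n \<oplus>\<^bsub>M\<^esub> k" "y = n' \<oplus>\<^bsub>M\<^esub> k'"
      using xy unfolding mem_set_add_iff by blast
    then have "x \<oplus>\<^bsub>M\<^esub> y = (n \<oplus>\<^bsub>M\<^esub> n') \<oplus>\<^bsub>M\<^esub> (k \<oplus>\<^bsub>M\<^esub> k')"
      by (simp add: c M.a_ac)
    then show ?thesis
      using h right_submoduleD(3)[OF N] right_submoduleD(3)[OF K]
      unfolding mem_set_add_iff by blast
  qed
  moreover have "x \<odot>\<^sub>r\<^bsub>M\<^esub> a \<in> N <+>\<^bsub>M\<^esub> K" if x: "x \<in> N <+>\<^bsub>M\<^esub> K" and a: "a \<in> carrier R" for x a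
  proof -
    obtain n k where h: "n \<in> N" "k \<in> K" "x = n \<oplus>\<^bsub>M\<^esub> k"
      using x unfolding mem_set_add_iff by blast
    then have "x \<odot>\<^sub>r\<^bsub>M\<^esub> a = n \<odot>\<^sub>r\<^bsub>M\<^esub> a \<oplus>\<^bsub>M\<^esub> k \<odot>\<^sub>r\<^bsub>M\<^esub> a"
      using a by (simp add: c rsmult_add_left)
    then show ?thesis
      using h right_submoduleD(4)[OF N _ a] right_submoduleD(4)[OF K _ a]
      unfolding mem_set_add_iff by blast
  qed
  moreover have "\<zero>\<^bsub>M\<^esub> \<in> N <+>\<^bsub>M\<^esub> K"
    using right_submoduleD(2)[OF N] right_submoduleD(2)[OF K] M.r_zero[OF M.zero_closed]
    unfolding mem_set_add_iff by metis
  moreover have "N <+>\<^bsub>M\<^esub> K \<subseteq> carrier M"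
    using c unfolding set_add_def' by auto
  ultimately show ?thesis
    unfolding right_submodule_iff by blast
qed

text \<open>
  This set is the projection of \<open>K \<inter> (A + B)\<close> to \<open>A\<close> along \<open>B\<close>, when \<open>A \<inter> B = 0\<close>;
  describing it by a set avoids choosing components.
\<close>

lemma right_submodule_projection:
  assumes A: "right_submodule R M A" and B: "right_submodule R M B" and K: "right_submodule R M K"
  shows "right_submodule R M {x \<in> A. \<exists>y\<in>B. x \<oplus>\<^bsub>M\<^esub> y \<in> K}" (is "right_submodule R M ?X")
proof -
  note cA = subsetD[OF right_submoduleD(1)[OF A]] and cB = subsetD[OF right_submoduleD(1)[OF B]]
  have "x \<oplus>\<^bsub>M\<^esub> x' \<in> ?X" if xx': "x \<in> ?X" "x' \<in> ?X" for x x'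
  proof -
    obtain y y' where h: "x \<in> A" "x' \<in> A" "y \<in> B" "y' \<in> B"
        "x \<oplus>\<^bsub>M\<^esub> y \<in> K" "x' \<oplus>\<^bsub>M\<^esub> y' \<in> K"
      using xx' by blast
    have "(x \<oplus>\<^bsub>M\<^esub> y) \<oplus>\<^bsub>M\<^esub> (x' \<oplus>\<^bsub>M\<^esub> y') = (x \<oplus>\<^bsub>M\<^esub> x') \<oplus>\<^bsub>M\<^esub> (y \<oplus>\<^bsub>M\<^esub> y')"
      using h(1-4) cA cB by (simp add: M.a_ac)
    with right_submoduleD(3)[OF K h(5,6)]
    have "(x \<oplus>\<^bsub>M\<^esub> x') \<oplus>\<^bsub>M\<^esub> (y \<oplus>\<^bsub>M\<^esub> y') \<in> K" by simp
    then show ?thesis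
      using right_submoduleD(3)[OF A h(1,2)] right_submoduleD(3)[OF B h(3,4)] by blast
  qed
  moreover have "x \<odot>\<^sub>r\<^bsub>M\<^esub> a \<in> ?X" if x: "x \<in> ?X" and a: "a \<in> carrier R" for x a
  proof -
    obtain y where h: "x \<in> A" "y \<in> B" "x \<oplus>\<^bsub>M\<^esub> y \<in> K"
      using x by blast
    have "x \<odot>\<^sub>r\<^bsub>M\<^esub> a \<oplus>\<^bsub>M\<^esub> y \<odot>\<^sub>r\<^bsub>M\<^esub> a \<in> K"
      using right_submoduleD(4)[OF K h(3) a] rsmult_add_left[OF cA[OF h(1)] cB[OF h(2)] a] by simp
    then show ?thesis
      using right_submoduleD(4)[OF A h(1) a] right_submoduleD(4)[OF B h(2) a] by blast
  qed
  moreover have "\<exists>y\<in>B. \<zero>\<^bsub>M\<^esub> \<oplus>\<^bsub>M\<^esub> y \<in> K"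
    using right_submoduleD(2)[OF B] right_submoduleD(2)[OF K] by (intro bexI[of _ "\<zero>\<^bsub>M\<^esub>"]) simp_all
  then have "\<zero>\<^bsub>M\<^esub> \<in> ?X"
    using right_submoduleD(2)[OF A] by blast
  moreover have "?X \<subseteq> carrier M" using cA by blast
  ultimately show ?thesis
    unfolding right_submodule_iff by blast
qed

lemma restrict_right_module:
  assumes N: "right_submodule R M N"
  shows "right_module R (restrict_module M N)"
proof -
  note c = subsetD[OF right_submoduleD(1)[OF N]]
  have neg: "\<exists>y\<in>N. x \<oplus>\<^bsub>M\<^esub> y = \<zero>\<^bsub>M\<^esub>" if "x \<in> N" for x
    using right_submodule_minus[OF N right_submoduleD(2)[OF N] that] minus_add_cancel(3) c
      M.zero_closed that by metis
  have "abelian_group (restrict_module M N)"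
    by (rule abelian_groupI) (simp_all add: right_submoduleD(2,3)[OF N] c M.a_ac neg)
  moreover have "right_module_axioms R (restrict_module M N)"
    by (rule right_module_axioms.intro)
       (simp_all add: right_submoduleD(4)[OF N] c rsmult_add_left rsmult_add_right rsmult_assoc
         rsmult_one)
  ultimately show ?thesis
    by (rule right_module.intro[OF R.ring_axioms])
qed

lemma right_submodule_restrict_iff:
  assumes "right_submodule R M N"
  shows "right_submodule R (restrict_module M N) K \<longleftrightarrow> right_submodule R M K \<and> K \<subseteq> N"
  using right_submoduleD(1)[OF assms]
  unfolding right_submodule_iff right_module.right_submodule_iff[OF restrict_right_module[OF assms]]
  by auto

lemma direct_summand_restrictE:
  assumes "right_submodule R M N" "direct_summand R (restrict_module M N) S"
  obtains K where "right_submodule R M K" "K \<subseteq> N" "internal_direct_sum M N S K"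
  using assms(2) unfolding direct_summand_def right_submodule_restrict_iff[OF assms(1)]
  by (auto simp: internal_direct_sum_def set_add_def')

lemma internal_direct_sum_unique:
  assumes "right_submodule R M N" "right_submodule R M K" "internal_direct_sum M S N K"
    and "x \<in> N" "x' \<in> N" "y \<in> K" "y' \<in> K" and eq: "x \<oplus>\<^bsub>M\<^esub> y = x' \<oplus>\<^bsub>M\<^esub> y'"
  shows "x = x'" "y = y'"
proof -
  have c: "x \<in> carrier M" "x' \<in> carrier M" "y \<in> carrier M" "y' \<in> carrier M"
    using assms(4-7) right_submoduleD(1)[OF assms(1)] right_submoduleD(1)[OF assms(2)] by auto
  have "x \<ominus>\<^bsub>M\<^esub> x' = y' \<ominus>\<^bsub>M\<^esub> y"
  proof -
    have "x \<ominus>\<^bsub>M\<^esub> x' = ((x \<oplus>\<^bsub>M\<^esub> y) \<ominus>\<^bsub>M\<^esub> y) \<ominus>\<^bsub>M\<^esub> x'"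
      using c by (simp add: minus_add_cancel)
    also have "\<dots> = (x' \<oplus>\<^bsub>M\<^esub> (y' \<ominus>\<^bsub>M\<^esub> y)) \<ominus>\<^bsub>M\<^esub> x'"
      unfolding eq using c by (simp add: a_minus_def M.a_assoc)
    also have "\<dots> = y' \<ominus>\<^bsub>M\<^esub> y"
      using c by (simp add: minus_add_cancel)
    finally show ?thesis .
  qed
  moreover have "x \<ominus>\<^bsub>M\<^esub> x' \<in> N" "y' \<ominus>\<^bsub>M\<^esub> y \<in> K"
    using assms by (auto intro: right_submodule_minus)
  ultimately have "x \<ominus>\<^bsub>M\<^esub> x' = \<zero>\<^bsub>M\<^esub>"
    using assms(3) unfolding internal_direct_sum_def by auto
  then show "x = x'"
    using c minus_add_cancel(4)[of x' x] by simp
  then show "y = y'"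
    using minus_add_cancel(2)[OF c(1) c(3)] minus_add_cancel(2)[OF c(2) c(4)] eq by metis
qed

end

lemma direct_sum_right_module:
  assumes "right_module R A" "right_module R B"
  shows "right_module R (direct_sum_module A B)"
proof -
  interpret A: right_module R A by fact
  interpret B: right_module R B by fact
  have "abelian_group (direct_sum_module A B)"
    by (rule abelian_groupI)
       (auto simp: direct_sum_module_def A.M.a_ac B.M.a_ac
         intro: A.M.add.l_inv_ex B.M.add.l_inv_ex)
  moreover have "right_module_axioms R (direct_sum_module A B)"
    by (rule right_module_axioms.intro)
       (auto simp: direct_sum_module_def A.rsmult_closed B.rsmult_closed
         A.rsmult_add_left B.rsmult_add_left A.rsmult_add_right B.rsmult_add_right
         A.rsmult_assoc B.rsmult_assoc A.rsmult_one B.rsmult_one)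
  ultimately show ?thesis
    by (rule right_module.intro[OF A.R.ring_axioms])
qed

section \<open>Essential right ideals\<close>

context right_module
begin

lemma regular_right_module: "right_module R (regular_module R)"
proof -
  have "abelian_group (regular_module R)"
    by (rule abelian_groupI)
       (auto simp: regular_module_def R.a_ac intro: R.add.l_inv_ex)
  moreover have "right_module_axioms R (regular_module R)"
    by (rule right_module_axioms.intro)
       (simp_all add: regular_module_def R.l_distr R.r_distr R.m_assoc)
  ultimately show ?thesis
    by (rule right_module.intro[OF R.ring_axioms])
qed

lemma right_ideal_iff:
  "right_submodule R (regular_module R) I \<longleftrightarrow>
     I \<subseteq> carrier R \<and> \<zero>\<^bsub>R\<^esub> \<in> I \<and> (\<forall>x\<in>I. \<forall>y\<in>I. x \<oplus>\<^bsub>R\<^esub> y \<in> I) \<and>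
     (\<forall>x\<in>I. \<forall>a\<in>carrier R. x \<otimes>\<^bsub>R\<^esub> a \<in> I)"
  using right_module.right_submodule_iff[OF regular_right_module]
  by (simp add: regular_module_def)

lemma essential_right_ideal_iff:
  "essential_right_ideal R I \<longleftrightarrow>
     right_submodule R (regular_module R) I \<and>
     (\<forall>T. right_submodule R (regular_module R) T \<and> I \<inter> T \<subseteq> {\<zero>\<^bsub>R\<^esub>} \<longrightarrow> T \<subseteq> {\<zero>\<^bsub>R\<^esub>})"
proof -
  have "T = {\<zero>\<^bsub>R\<^esub>} \<longleftrightarrow> T \<subseteq> {\<zero>\<^bsub>R\<^esub>}" "I \<inter> T = {\<zero>\<^bsub>R\<^esub>} \<longleftrightarrow> I \<inter> T \<subseteq> {\<zero>\<^bsub>R\<^esub>}"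
    if "right_submodule R (regular_module R) I" "right_submodule R (regular_module R) T" for T
    using that by (auto simp only: right_ideal_iff)
  moreover have "\<zero>\<^bsub>regular_module R\<^esub> = \<zero>\<^bsub>R\<^esub>"
    by (simp add: regular_module_def)
  ultimately show ?thesis
    unfolding essential_submodule_def by metis
qed

lemma essential_right_ideal_carrier: "essential_right_ideal R (carrier R)"
  unfolding essential_right_ideal_iff by (auto simp: right_ideal_iff)

lemma essential_right_ideal_Int:
  assumes "essential_right_ideal R I" "essential_right_ideal R J"
  shows "essential_right_ideal R (I \<inter> J)"
proof -
  have "T \<subseteq> {\<zero>\<^bsub>R\<^esub>}"
    if "right_submodule R (regular_module R) T" "I \<inter> J \<inter> T \<subseteq> {\<zero>\<^bsub>R\<^esub>}" for T
  proof -
    have "right_submodule R (regular_module R) (J \<inter> T)"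
      using assms(2) that(1) by (auto simp: essential_right_ideal_iff right_ideal_iff)
    then have "J \<inter> T \<subseteq> {\<zero>\<^bsub>R\<^esub>}"
      using assms(1) that(2) by (auto simp: essential_right_ideal_iff)
    then show ?thesis
      using assms(2) that(1) by (auto simp: essential_right_ideal_iff)
  qed
  moreover have "right_submodule R (regular_module R) (I \<inter> J)"
    using assms by (auto simp: essential_right_ideal_iff right_ideal_iff)
  ultimately show ?thesis
    unfolding essential_right_ideal_iff by blast
qed

lemma essential_right_ideal_mono:
  assumes "essential_right_ideal R I" "right_submodule R (regular_module R) J" "I \<subseteq> J"
  shows "essential_right_ideal R J"
  using assms unfolding essential_right_ideal_iff by (meson Int_mono subset_refl subset_trans)

text \<open>
  If \<open>T\<close> meets the residual in \<open>0\<close>, then the right ideal \<open>r T\<close> meets \<open>I\<close> in \<open>0\<close>, so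
  \<open>r T = 0\<close>.  But then \<open>T\<close> lies in the residual.
\<close>

lemma essential_right_ideal_residual:
  assumes "essential_right_ideal R I" "r \<in> carrier R"
  shows "essential_right_ideal R {s \<in> carrier R. r \<otimes>\<^bsub>R\<^esub> s \<in> I}" (is "essential_right_ideal R ?J")
proof -
  have I: "right_submodule R (regular_module R) I"
    using assms by (simp add: essential_right_ideal_iff)
  have "T \<subseteq> {\<zero>\<^bsub>R\<^esub>}"
    if T: "right_submodule R (regular_module R) T" and "?J \<inter> T \<subseteq> {\<zero>\<^bsub>R\<^esub>}" for T
  proof -
    have Tc: "T \<subseteq> carrier R" using T by (simp add: right_ideal_iff)
    have "right_submodule R (regular_module R) ((\<lambda>t. r \<otimes>\<^bsub>R\<^esub> t) ` T)"
      unfolding right_ideal_iff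
    proof (intro conjI ballI)
      show "(\<otimes>\<^bsub>R\<^esub>) r ` T \<subseteq> carrier R" using Tc assms(2) by auto
      show "\<zero>\<^bsub>R\<^esub> \<in> (\<otimes>\<^bsub>R\<^esub>) r ` T"
        using T assms(2) by (intro image_eqI[of _ _ "\<zero>\<^bsub>R\<^esub>"]) (auto simp: right_ideal_iff)
    next
      fix x y assume "x \<in> (\<otimes>\<^bsub>R\<^esub>) r ` T" "y \<in> (\<otimes>\<^bsub>R\<^esub>) r ` T"
      then obtain s t where "s \<in> T" "t \<in> T" "x = r \<otimes>\<^bsub>R\<^esub> s" "y = r \<otimes>\<^bsub>R\<^esub> t" by auto
      then show "x \<oplus>\<^bsub>R\<^esub> y \<in> (\<otimes>\<^bsub>R\<^esub>) r ` T"
        using T Tc assms(2)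
        by (intro image_eqI[of _ _ "s \<oplus>\<^bsub>R\<^esub> t"]) (auto simp: right_ideal_iff R.r_distr subset_iff)
    next
      fix x a assume "x \<in> (\<otimes>\<^bsub>R\<^esub>) r ` T" "a \<in> carrier R"
      then obtain s where "s \<in> T" "x = r \<otimes>\<^bsub>R\<^esub> s" by auto
      then show "x \<otimes>\<^bsub>R\<^esub> a \<in> (\<otimes>\<^bsub>R\<^esub>) r ` T"
        using T Tc assms(2) \<open>a \<in> carrier R\<close>
        by (intro image_eqI[of _ _ "s \<otimes>\<^bsub>R\<^esub> a"]) (auto simp: right_ideal_iff R.m_assoc subset_iff)
    qed
    moreover have "r \<otimes>\<^bsub>R\<^esub> t = \<zero>\<^bsub>R\<^esub>" if "t \<in> T" "r \<otimes>\<^bsub>R\<^esub> t \<in> I" for t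
      using that \<open>?J \<inter> T \<subseteq> _\<close> Tc assms(2) by (auto simp: subset_iff)
    ultimately have "(\<lambda>t. r \<otimes>\<^bsub>R\<^esub> t) ` T \<subseteq> {\<zero>\<^bsub>R\<^esub>}"
      using assms(1) by (auto simp: essential_right_ideal_iff)
    then have "T \<subseteq> ?J"
      using I Tc by (auto simp: right_ideal_iff)
    with \<open>?J \<inter> T \<subseteq> _\<close> show ?thesis by auto
  qed
  moreover have "right_submodule R (regular_module R) ?J"
    using I assms(2) by (auto simp: right_ideal_iff R.r_distr R.m_assoc[symmetric])
  ultimately show ?thesis
    unfolding essential_right_ideal_iff by blast
qed

section \<open>Submodules with nonsingular quotient\<close>

text \<open>
  In the quotient \<open>(N + m) a = N + m a\<close>, so a coset is killed by \<open>I\<close> exactly when its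
  representative is moved into \<open>N\<close> by \<open>I\<close>.  This removes the quotient module from all later arguments.
\<close>

lemma S_closed_iff:
  "S_closed R M N \<longleftrightarrow>
     right_submodule R M N \<and>
     (\<forall>m\<in>carrier M. \<forall>I. essential_right_ideal R I \<and> (\<forall>a\<in>I. m \<odot>\<^sub>r\<^bsub>M\<^esub> a \<in> N) \<longrightarrow> m \<in> N)"
proof (cases "right_submodule R M N")
  case True
  interpret N: abelian_subgroup N M
    by (rule abelian_subgroupI3[OF _ M.abelian_group_axioms])
       (use True in \<open>simp add: right_submodule_def\<close>)
  have Nc: "N \<subseteq> carrier M" by (rule N.a_subset)
  have coset_eq: "N +>\<^bsub>M\<^esub> m = N \<longleftrightarrow> m \<in> N" if "m \<in> carrier M" for m
    using that by (metis N.a_rcos_const N.a_rcos_self)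
  have smult: "(N +>\<^bsub>M\<^esub> m) \<odot>\<^sub>r\<^bsub>quotient_module M N\<^esub> a = N +>\<^bsub>M\<^esub> (m \<odot>\<^sub>r\<^bsub>M\<^esub> a)"
    if m: "m \<in> carrier M" and a: "a \<in> carrier R" for m a
  proof -
    have "N +>\<^bsub>M\<^esub> (x \<odot>\<^sub>r\<^bsub>M\<^esub> a) = N +>\<^bsub>M\<^esub> (m \<odot>\<^sub>r\<^bsub>M\<^esub> a)" if x: "x \<in> N +>\<^bsub>M\<^esub> m" for x
    proof -
      obtain n where n: "n \<in> N" "x = n \<oplus>\<^bsub>M\<^esub> m"
        using x unfolding a_r_coset_def' by blast
      then have "x \<odot>\<^sub>r\<^bsub>M\<^esub> a = n \<odot>\<^sub>r\<^bsub>M\<^esub> a \<oplus>\<^bsub>M\<^esub> m \<odot>\<^sub>r\<^bsub>M\<^esub> a"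
        using m a Nc by (auto simp: rsmult_add_left)
      moreover have "n \<odot>\<^sub>r\<^bsub>M\<^esub> a \<in> N"
        using True n a by (simp add: right_submodule_iff)
      ultimately have "x \<odot>\<^sub>r\<^bsub>M\<^esub> a \<in> N +>\<^bsub>M\<^esub> (m \<odot>\<^sub>r\<^bsub>M\<^esub> a)"
        unfolding a_r_coset_def' by blast
      then show ?thesis
        using N.a_repr_independence'[OF _ rsmult_closed[OF m a]] by simp
    qed
    then have "(\<Union>x\<in>N +>\<^bsub>M\<^esub> m. N +>\<^bsub>M\<^esub> (x \<odot>\<^sub>r\<^bsub>M\<^esub> a)) = N +>\<^bsub>M\<^esub> (m \<odot>\<^sub>r\<^bsub>M\<^esub> a)"
      using N.a_rcos_self[OF m] by blast
    then show ?thesis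
      by (simp add: quotient_module_def)
  qed
  have ann: "(N +>\<^bsub>M\<^esub> m) \<odot>\<^sub>r\<^bsub>quotient_module M N\<^esub> a = N \<longleftrightarrow> m \<odot>\<^sub>r\<^bsub>M\<^esub> a \<in> N"
    if "m \<in> carrier M" "a \<in> carrier R" for m a
    using that by (simp add: smult coset_eq rsmult_closed)
  have sub: "I \<subseteq> carrier R" if "essential_right_ideal R I" for I
    using that by (simp add: essential_right_ideal_iff right_ideal_iff)
  have Nq: "N \<in> carrier (quotient_module M N)"
    using coset_eq[of "\<zero>\<^bsub>M\<^esub>"] M.zero_closed N.zero_closed
    unfolding quotient_module_def A_RCOSETS_def' by auto
  have "N \<odot>\<^sub>r\<^bsub>quotient_module M N\<^esub> a = N" if "a \<in> carrier R" for a
    using that ann[of "\<zero>\<^bsub>M\<^esub>" a] coset_eq[of "\<zero>\<^bsub>M\<^esub>"] N.zero_closed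
    by (simp add: rsmult_zero_left)
  then have zero: "N \<in> singular_submodule R (quotient_module M N)"
    using Nq essential_right_ideal_carrier by (auto simp: singular_submodule_def quotient_module_def)
  have qc: "carrier (quotient_module M N) = (\<lambda>m. N +>\<^bsub>M\<^esub> m) ` carrier M"
    unfolding quotient_module_def A_RCOSETS_def' by auto
  have "nonsingular R (quotient_module M N) \<longleftrightarrow>
      (\<forall>X\<in>carrier (quotient_module M N). 
         (\<exists>I. essential_right_ideal R I \<and> (\<forall>a\<in>I. X \<odot>\<^sub>r\<^bsub>quotient_module M N\<^esub> a = N)) \<longrightarrow> X = N)"
    using zero by (auto simp: nonsingular_def singular_submodule_def quotient_module_def)
  also have "\<dots> \<longleftrightarrow> (\<forall>m\<in>carrier M. (\<exists>I. essential_right_ideal R I \<and>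
      (\<forall>a\<in>I. (N +>\<^bsub>M\<^esub> m) \<odot>\<^sub>r\<^bsub>quotient_module M N\<^esub> a = N)) \<longrightarrow> m \<in> N)"
    unfolding qc by (simp add: coset_eq)
  also have "\<dots> \<longleftrightarrow> (\<forall>m\<in>carrier M. (\<exists>I. essential_right_ideal R I \<and>
      (\<forall>a\<in>I. m \<odot>\<^sub>r\<^bsub>M\<^esub> a \<in> N)) \<longrightarrow> m \<in> N)"
    using ann sub by (metis (no_types, lifting) subsetD)
  finally show ?thesis
    using True by (auto simp: S_closed_def)
qed (simp add: S_closed_def)

end

text \<open>
  This is the preimage in \<open>M\<close> of the singular submodule of \<open>M/X\<close>.
\<close>

definition singular_closure ::
    "('a, 'r) ring_scheme \<Rightarrow> ('a, 'm, 'z) rmodule_scheme \<Rightarrow> 'm set \<Rightarrow> 'm set" where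
  "singular_closure R M X =
     {m \<in> carrier M. essential_right_ideal R {r \<in> carrier R. m \<odot>\<^sub>r\<^bsub>M\<^esub> r \<in> X}}"

context right_module
begin

lemma singular_closureI:
  assumes X: "right_submodule R M X" and "m \<in> carrier M"
    and I: "essential_right_ideal R I" "\<And>a. a \<in> I \<Longrightarrow> m \<odot>\<^sub>r\<^bsub>M\<^esub> a \<in> X"
  shows "m \<in> singular_closure R M X"
proof -
  have "right_submodule R (regular_module R) {r \<in> carrier R. m \<odot>\<^sub>r\<^bsub>M\<^esub> r \<in> X}"
    using right_submoduleD[OF X] \<open>m \<in> carrier M\<close>
    by (auto simp: right_ideal_iff rsmult_zero_right rsmult_add_right rsmult_assoc)
  moreover have "I \<subseteq> {r \<in> carrier R. m \<odot>\<^sub>r\<^bsub>M\<^esub> r \<in> X}"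
    using I by (auto simp: essential_right_ideal_iff right_ideal_iff)
  ultimately show ?thesis
    using essential_right_ideal_mono[OF I(1)] \<open>m \<in> carrier M\<close> by (simp add: singular_closure_def)
qed

lemma singular_closure_superset:
  assumes X: "right_submodule R M X"
  shows "X \<subseteq> singular_closure R M X"
  using singular_closureI[OF X _ essential_right_ideal_carrier] right_submoduleD(1,4)[OF X] by blast

lemma right_submodule_singular_closure:
  assumes X: "right_submodule R M X"
  shows "right_submodule R M (singular_closure R M X)"
proof -
  have "x \<oplus>\<^bsub>M\<^esub> y \<in> singular_closure R M X"
    if "x \<in> singular_closure R M X" "y \<in> singular_closure R M X" for x y
  proof -
    have xy: "x \<in> carrier M" "y \<in> carrier M"
      using that by (auto simp: singular_closure_def)
    have "essential_right_ideal R
        ({r \<in> carrier R. x \<odot>\<^sub>r\<^bsub>M\<^esub> r \<in> X} \<inter> {r \<in> carrier R. y \<odot>\<^sub>r\<^bsub>M\<^esub> r \<in> X})"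
      using that by (intro essential_right_ideal_Int) (auto simp: singular_closure_def)
    then show ?thesis
      using xy right_submoduleD(3)[OF X]
      by (elim singular_closureI[OF X, rotated]) (auto simp: rsmult_add_left)
  qed
  moreover have "x \<odot>\<^sub>r\<^bsub>M\<^esub> a \<in> singular_closure R M X"
    if "x \<in> singular_closure R M X" and a: "a \<in> carrier R" for x a
  proof -
    have x: "x \<in> carrier M"
      using that by (auto simp: singular_closure_def)
    have "essential_right_ideal R {s \<in> carrier R. a \<otimes>\<^bsub>R\<^esub> s \<in> {r \<in> carrier R. x \<odot>\<^sub>r\<^bsub>M\<^esub> r \<in> X}}"
      using that by (intro essential_right_ideal_residual) (auto simp: singular_closure_def)
    then show ?thesis
      using x a
      by (elim singular_closureI[OF X, rotated]) (auto simp: rsmult_closed rsmult_assoc)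
  qed
  moreover have "\<zero>\<^bsub>M\<^esub> \<in> singular_closure R M X"
    using singular_closure_superset[OF X] right_submoduleD(2)[OF X] by blast
  moreover have "singular_closure R M X \<subseteq> carrier M"
    by (auto simp: singular_closure_def)
  ultimately show ?thesis
    unfolding right_submodule_iff by blast
qed

text \<open>
  In general the singular submodule of \<open>M/X\<close> need not have a nonsingular quotient; the operation
  has to be applied twice.  Once is enough when \<open>X\<close> contains the singular submodule of \<open>M\<close>: if
  \<open>m I\<close> lies in the closure and \<open>T\<close> meets \<open>J = {r. m r \<in> X}\<close> in \<open>0\<close>, then for \<open>t \<in> I \<inter> T\<close> an
  essential right ideal \<open>K\<close> satisfies \<open>m t K \<subseteq> X\<close>, so \<open>t K \<subseteq> J \<inter> T = 0\<close>.  Thus \<open>m t\<close> is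
  singular, hence lies in \<open>X\<close>, and \<open>t \<in> J \<inter> T = 0\<close>.
\<close>

lemma S_closed_singular_closure:
  assumes X: "right_submodule R M X" and Z: "singular_submodule R M \<subseteq> X"
  shows "S_closed R M (singular_closure R M X)"
  unfolding S_closed_iff
proof (intro conjI ballI allI impI right_submodule_singular_closure[OF X])
  fix m I
  assume m: "m \<in> carrier M"
    and "essential_right_ideal R I \<and> (\<forall>a\<in>I. m \<odot>\<^sub>r\<^bsub>M\<^esub> a \<in> singular_closure R M X)"
  then have I: "essential_right_ideal R I"
    and mI: "\<And>a. a \<in> I \<Longrightarrow> m \<odot>\<^sub>r\<^bsub>M\<^esub> a \<in> singular_closure R M X" by auto
  let ?J = "{r \<in> carrier R. m \<odot>\<^sub>r\<^bsub>M\<^esub> r \<in> X}"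
  have "T \<subseteq> {\<zero>\<^bsub>R\<^esub>}"
    if T: "right_submodule R (regular_module R) T" and JT: "?J \<inter> T \<subseteq> {\<zero>\<^bsub>R\<^esub>}" for T
  proof -
    have T': "T \<subseteq> carrier R" "\<And>x a. \<lbrakk>x \<in> T; a \<in> carrier R\<rbrakk> \<Longrightarrow> x \<otimes>\<^bsub>R\<^esub> a \<in> T"
      using T unfolding right_ideal_iff by auto
    \<comment> \<open>As \<open>I\<close> is essential, it suffices that \<open>I \<inter> T = 0\<close>.\<close>
    have "t = \<zero>\<^bsub>R\<^esub>" if t: "t \<in> I" "t \<in> T" for t
    proof -
      let ?K = "{r \<in> carrier R. (m \<odot>\<^sub>r\<^bsub>M\<^esub> t) \<odot>\<^sub>r\<^bsub>M\<^esub> r \<in> X}"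
      have tc: "t \<in> carrier R" using t T' by auto
      have K: "essential_right_ideal R ?K"
        using mI[OF t(1)] by (simp add: singular_closure_def)
      have "(m \<odot>\<^sub>r\<^bsub>M\<^esub> t) \<odot>\<^sub>r\<^bsub>M\<^esub> r = \<zero>\<^bsub>M\<^esub>" if "r \<in> ?K" for r
      proof -
        have "t \<otimes>\<^bsub>R\<^esub> r \<in> ?J \<inter> T"
          using that t(2) T' tc m by (auto simp: rsmult_assoc)
        then have "t \<otimes>\<^bsub>R\<^esub> r = \<zero>\<^bsub>R\<^esub>" using JT by blast
        then show ?thesis
          using that m tc rsmult_assoc[OF m tc, of r] by (simp add: rsmult_zero_right)
      qed
      then have "m \<odot>\<^sub>r\<^bsub>M\<^esub> t \<in> singular_submodule R M"
        using K m tc unfolding singular_submodule_def by (blast intro: rsmult_closed)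
      then show ?thesis
        using Z JT t tc by blast
    qed
    then show ?thesis
      using I T unfolding essential_right_ideal_iff by blast
  qed
  moreover have "right_submodule R (regular_module R) ?J"
    using right_submoduleD[OF X] m
    by (auto simp: right_ideal_iff rsmult_zero_right rsmult_add_right rsmult_assoc)
  ultimately show "m \<in> singular_closure R M X"
    using m unfolding singular_closure_def essential_right_ideal_iff by blast
qed

section \<open>Ojectivity inside an internal direct sum\<close>

text \<open>
  Ojectivity is defined in the external sum \<open>A \<times> B\<close>.  The isomorphism \<open>(x, y) \<mapsto> x + y\<close> onto \<open>M\<close>
  carries \<open>C\<^sub>P\<close> to \<open>C\<close> and \<open>{0} \<times> B\<close> to \<open>B\<close>; it transports the complement to \<open>A \<times> B\<close> and
  the resulting decomposition back to \<open>M\<close>.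
\<close>

lemma ojective_complement_decomposition:
  assumes A: "right_submodule R M A" and B: "right_submodule R M B"
    and AB: "internal_direct_sum M (carrier M) A B"
    and oj: "ojective R (restrict_module M A) (restrict_module M B)"
    and C: "complement_of R M B C"
  obtains A' B' where "right_submodule R M A'" "A' \<subseteq> A" "right_submodule R M B'" "B' \<subseteq> B"
    "internal_direct_sum M (C <+>\<^bsub>M\<^esub> A') C A'"
    "internal_direct_sum M (carrier M) (C <+>\<^bsub>M\<^esub> A') B'"
proof -
  define P where "P = direct_sum_module (restrict_module M A) (restrict_module M B)"
  interpret P: right_module R P
    unfolding P_def by (intro direct_sum_right_module restrict_right_module A B)
  have P_simps: "carrier P = A \<times> B" "\<zero>\<^bsub>P\<^esub> = (\<zero>\<^bsub>M\<^esub>, \<zero>\<^bsub>M\<^esub>)"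
    "\<And>x y x' y'. (x, y) \<oplus>\<^bsub>P\<^esub> (x', y') = (x \<oplus>\<^bsub>M\<^esub> x', y \<oplus>\<^bsub>M\<^esub> y')"
    "\<And>x y a. (x, y) \<odot>\<^sub>r\<^bsub>P\<^esub> a = (x \<odot>\<^sub>r\<^bsub>M\<^esub> a, y \<odot>\<^sub>r\<^bsub>M\<^esub> a)"
    by (simp_all add: P_def direct_sum_module_def)
  note cA = subsetD[OF right_submoduleD(1)[OF A]] and cB = subsetD[OF right_submoduleD(1)[OF B]]
  note uniq = internal_direct_sum_unique[OF A B AB]
  have split: "\<exists>x\<in>A. \<exists>y\<in>B. m = x \<oplus>\<^bsub>M\<^esub> y" if "m \<in> carrier M" for m
    using AB that unfolding internal_direct_sum_def by (auto simp: set_add_def')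
  have Csub: "right_submodule R M C" and CB: "C \<inter> B = {\<zero>\<^bsub>M\<^esub>}"
    and Cmax: "\<And>D. \<lbrakk>right_submodule R M D; D \<inter> B = {\<zero>\<^bsub>M\<^esub>}; C \<subseteq> D\<rbrakk> \<Longrightarrow> D = C"
    using C unfolding complement_of_def by blast+
  have add4: "(x \<oplus>\<^bsub>M\<^esub> x') \<oplus>\<^bsub>M\<^esub> (y \<oplus>\<^bsub>M\<^esub> y') = (x \<oplus>\<^bsub>M\<^esub> y) \<oplus>\<^bsub>M\<^esub> (x' \<oplus>\<^bsub>M\<^esub> y')"
    if "x \<in> A" "x' \<in> A" "y \<in> B" "y' \<in> B" for x x' y y'
    using that cA cB by (simp add: M.a_ac)
  define C\<^sub>P where "C\<^sub>P = {(x, y). x \<in> A \<and> y \<in> B \<and> x \<oplus>\<^bsub>M\<^esub> y \<in> C}"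
  have "complement_of R P ({\<zero>\<^bsub>M\<^esub>} \<times> B) C\<^sub>P"
    unfolding complement_of_def
  proof (intro conjI allI impI)
    show "right_submodule R P C\<^sub>P"
      unfolding P.right_submodule_iff C\<^sub>P_def P_simps
      using right_submoduleD(2-)[OF A] right_submoduleD(2-)[OF B] right_submoduleD(2-)[OF Csub]
      by (auto simp: P_simps add4 cA cB rsmult_add_left[symmetric])
    show "C\<^sub>P \<inter> {\<zero>\<^bsub>M\<^esub>} \<times> B = {\<zero>\<^bsub>P\<^esub>}"
    proof -
      have "y = \<zero>\<^bsub>M\<^esub>" if "y \<in> B" "\<zero>\<^bsub>M\<^esub> \<oplus>\<^bsub>M\<^esub> y \<in> C" for y
        using that CB by (auto simp: cB)
      then show ?thesis
        using right_submoduleD(2)[OF A] right_submoduleD(2)[OF B] right_submoduleD(2)[OF Csub]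
        unfolding C\<^sub>P_def P_simps by auto
    qed
  next
    fix D assume D: "right_submodule R P D \<and> D \<inter> {\<zero>\<^bsub>M\<^esub>} \<times> B = {\<zero>\<^bsub>P\<^esub>} \<and> C\<^sub>P \<subseteq> D"
    then have Dsub: "right_submodule R P D" and DB: "D \<inter> {\<zero>\<^bsub>M\<^esub>} \<times> B = {\<zero>\<^bsub>P\<^esub>}"
      and CD: "C\<^sub>P \<subseteq> D" by auto
    have DAB: "D \<subseteq> A \<times> B"
      using P.right_submoduleD(1)[OF Dsub] by (simp add: P_simps)
    define D' where "D' = (\<lambda>(x, y). x \<oplus>\<^bsub>M\<^esub> y) ` D"
    have D'I: "x \<oplus>\<^bsub>M\<^esub> y \<in> D'" if "(x, y) \<in> D" for x y
      using that by (force simp: D'_def)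
    have D'E: "\<exists>x\<in>A. \<exists>y\<in>B. (x, y) \<in> D \<and> m = x \<oplus>\<^bsub>M\<^esub> y" if "m \<in> D'" for m
      using that DAB by (fastforce simp: D'_def)
    have D'sub: "right_submodule R M D'"
      unfolding right_submodule_iff
    proof (intro conjI ballI)
      show "D' \<subseteq> carrier M" using D'E cA cB by blast
      show "\<zero>\<^bsub>M\<^esub> \<in> D'"
        using D'I[of "\<zero>\<^bsub>M\<^esub>" "\<zero>\<^bsub>M\<^esub>"] P.right_submoduleD(2)[OF Dsub] by (simp add: P_simps)
    next
      fix m m' assume "m \<in> D'" "m' \<in> D'"
      then obtain x y x' y' where "x \<in> A" "y \<in> B" "x' \<in> A" "y' \<in> B" "(x, y) \<in> D" "(x', y') \<in> D"
        "m = x \<oplus>\<^bsub>M\<^esub> y" "m' = x' \<oplus>\<^bsub>M\<^esub> y'" using D'E by metis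
      then show "m \<oplus>\<^bsub>M\<^esub> m' \<in> D'"
        using P.right_submoduleD(3)[OF Dsub, of "(x, y)" "(x', y')"] D'I
        by (simp add: P_simps add4[symmetric])
    next
      fix m a assume "m \<in> D'" and a: "a \<in> carrier R"
      then obtain x y where "x \<in> A" "y \<in> B" "(x, y) \<in> D" "m = x \<oplus>\<^bsub>M\<^esub> y" using D'E by metis
      then show "m \<odot>\<^sub>r\<^bsub>M\<^esub> a \<in> D'"
        using P.right_submoduleD(4)[OF Dsub, of "(x, y)" a] D'I a
        by (simp add: P_simps rsmult_add_left cA cB)
    qed
    have D'B: "m = \<zero>\<^bsub>M\<^esub>" if m: "m \<in> D'" "m \<in> B" for m
    proof -
      obtain x y where xy: "x \<in> A" "y \<in> B" "(x, y) \<in> D" "m = x \<oplus>\<^bsub>M\<^esub> y" using D'E m by metis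
      have "x \<oplus>\<^bsub>M\<^esub> y = \<zero>\<^bsub>M\<^esub> \<oplus>\<^bsub>M\<^esub> m"
        unfolding M.l_zero[OF cB[OF m(2)]] by (rule xy(4)[symmetric])
      then have "x = \<zero>\<^bsub>M\<^esub>"
        using uniq(1) xy(1,2) m(2) right_submoduleD(2)[OF A] by blast
      then have "(x, y) \<in> {\<zero>\<^bsub>P\<^esub>}"
        using DB xy(2,3) by blast
      then show ?thesis
        using xy(4) by (simp add: P_simps)
    qed
    have CD': "C \<subseteq> D'"
    proof
      fix c assume c: "c \<in> C"
      then obtain x y where "x \<in> A" "y \<in> B" "c = x \<oplus>\<^bsub>M\<^esub> y"
        using split right_submoduleD(1)[OF Csub] by blast
      then show "c \<in> D'" using c CD D'I by (auto simp: C\<^sub>P_def)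
    qed
    have "D' \<inter> B = {\<zero>\<^bsub>M\<^esub>}"
      using D'B right_submoduleD(2)[OF B] right_submoduleD(2)[OF D'sub] by blast
    then have "D' = C"
      by (rule Cmax[OF D'sub _ CD'])
    then have "D \<subseteq> C\<^sub>P"
      using DAB D'I by (auto simp: C\<^sub>P_def)
    with CD show "D = C\<^sub>P" by blast
  qed
  then obtain A' B' where A'0: "right_submodule R (restrict_module M A) A'"
    and B'0: "right_submodule R (restrict_module M B) B'"
    and int1: "internal_direct_sum P (C\<^sub>P <+>\<^bsub>P\<^esub> (A' \<times> {\<zero>\<^bsub>M\<^esub>})) C\<^sub>P (A' \<times> {\<zero>\<^bsub>M\<^esub>})"
    and int2: "internal_direct_sum P (carrier P) (C\<^sub>P <+>\<^bsub>P\<^esub> (A' \<times> {\<zero>\<^bsub>M\<^esub>})) ({\<zero>\<^bsub>M\<^esub>} \<times> B')"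
    using oj unfolding ojective_def Let_def P_def[symmetric] by auto
  have A': "right_submodule R M A'" "A' \<subseteq> A" and B': "right_submodule R M B'" "B' \<subseteq> B"
    using A'0 B'0 right_submodule_restrict_iff[OF A] right_submodule_restrict_iff[OF B] by auto
  have CA': "right_submodule R M (C <+>\<^bsub>M\<^esub> A')"
    by (rule right_submodule_set_add[OF Csub A'(1)])
  have "C \<inter> A' \<subseteq> {\<zero>\<^bsub>M\<^esub>}"
  proof
    fix x assume x: "x \<in> C \<inter> A'"
    then have "(x, \<zero>\<^bsub>M\<^esub>) \<in> C\<^sub>P \<inter> A' \<times> {\<zero>\<^bsub>M\<^esub>}"
      using A'(2) cA right_submoduleD(2)[OF B] by (auto simp: C\<^sub>P_def)
    then show "x \<in> {\<zero>\<^bsub>M\<^esub>}"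
      using int1 by (auto simp: internal_direct_sum_def P_simps)
  qed
  then have 1: "internal_direct_sum M (C <+>\<^bsub>M\<^esub> A') C A'"
    using right_submoduleD(2)[OF Csub] right_submoduleD(2)[OF A'(1)]
    by (auto simp: internal_direct_sum_def)
  have "(C <+>\<^bsub>M\<^esub> A') \<inter> B' \<subseteq> {\<zero>\<^bsub>M\<^esub>}"
  proof
    fix b assume "b \<in> (C <+>\<^bsub>M\<^esub> A') \<inter> B'"
    then have b: "b \<in> B'" and "b \<in> C <+>\<^bsub>M\<^esub> A'" by auto
    then obtain c a where ca: "c \<in> C" "a \<in> A'" "b = c \<oplus>\<^bsub>M\<^esub> a"
      unfolding mem_set_add_iff by blast
    obtain x y where xy: "x \<in> A" "y \<in> B" "c = x \<oplus>\<^bsub>M\<^esub> y"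
      using split right_submoduleD(1)[OF Csub] ca by blast
    have "a \<in> A" using A'(2) ca by auto
    have "(x \<oplus>\<^bsub>M\<^esub> a) \<oplus>\<^bsub>M\<^esub> y = \<zero>\<^bsub>M\<^esub> \<oplus>\<^bsub>M\<^esub> b"
      using xy ca \<open>a \<in> A\<close> cA cB by (simp add: M.a_ac)
    then have "x \<oplus>\<^bsub>M\<^esub> a = \<zero>\<^bsub>M\<^esub>" "y = b"
      using uniq[of "x \<oplus>\<^bsub>M\<^esub> a" "\<zero>\<^bsub>M\<^esub>" y b] right_submoduleD(2,3)[OF A] xy b B'(2) \<open>a \<in> A\<close>
      by blast+
    then have "(\<zero>\<^bsub>M\<^esub>, b) = (x, y) \<oplus>\<^bsub>P\<^esub> (a, \<zero>\<^bsub>M\<^esub>)"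
      using xy cB by (simp add: P_simps)
    moreover have "(x, y) \<in> C\<^sub>P" using xy ca by (simp add: C\<^sub>P_def)
    moreover have "(a, \<zero>\<^bsub>M\<^esub>) \<in> A' \<times> {\<zero>\<^bsub>M\<^esub>}" using ca by simp
    ultimately have "(\<zero>\<^bsub>M\<^esub>, b) \<in> C\<^sub>P <+>\<^bsub>P\<^esub> (A' \<times> {\<zero>\<^bsub>M\<^esub>})"
      unfolding mem_set_add_iff by metis
    then have "(\<zero>\<^bsub>M\<^esub>, b) \<in> {\<zero>\<^bsub>P\<^esub>}"
      using int2 b unfolding internal_direct_sum_def by blast
    then show "b \<in> {\<zero>\<^bsub>M\<^esub>}" by (simp add: P_simps)
  qed
  moreover have "carrier M \<subseteq> (C <+>\<^bsub>M\<^esub> A') <+>\<^bsub>M\<^esub> B'"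
  proof
    fix m assume "m \<in> carrier M"
    then obtain x y where xy: "x \<in> A" "y \<in> B" "m = x \<oplus>\<^bsub>M\<^esub> y" using split by blast
    then have "(x, y) \<in> (C\<^sub>P <+>\<^bsub>P\<^esub> (A' \<times> {\<zero>\<^bsub>M\<^esub>})) <+>\<^bsub>P\<^esub> ({\<zero>\<^bsub>M\<^esub>} \<times> B')"
      using int2 unfolding internal_direct_sum_def P_simps by blast
    then obtain d b where d: "d \<in> C\<^sub>P <+>\<^bsub>P\<^esub> (A' \<times> {\<zero>\<^bsub>M\<^esub>})" and b: "b \<in> B'"
      and xyd: "(x, y) = d \<oplus>\<^bsub>P\<^esub> (\<zero>\<^bsub>M\<^esub>, b)"
      unfolding mem_set_add_iff[where B = "{\<zero>\<^bsub>M\<^esub>} \<times> B'"] by blast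
    from d obtain u v a where a: "(u, v) \<in> C\<^sub>P" "a \<in> A'" "d = (u, v) \<oplus>\<^bsub>P\<^esub> (a, \<zero>\<^bsub>M\<^esub>)"
      unfolding mem_set_add_iff by auto
    note h = a(1,2) b xyd[unfolded a(3)]
    have uv: "u \<in> A" "v \<in> B" "u \<oplus>\<^bsub>M\<^esub> v \<in> C" "a \<in> A" "b \<in> B"
      using h A'(2) B'(2) by (auto simp: C\<^sub>P_def)
    then have "m = ((u \<oplus>\<^bsub>M\<^esub> v) \<oplus>\<^bsub>M\<^esub> a) \<oplus>\<^bsub>M\<^esub> b"
      using h(4) xy(3) cA cB by (simp add: P_simps M.a_ac)
    then show "m \<in> (C <+>\<^bsub>M\<^esub> A') <+>\<^bsub>M\<^esub> B'"
      using h uv unfolding set_add_def' by blast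
  qed
  moreover have "(C <+>\<^bsub>M\<^esub> A') <+>\<^bsub>M\<^esub> B' \<subseteq> carrier M"
    using right_submoduleD(1)[OF right_submodule_set_add[OF CA' B'(1)]] .
  ultimately have 2: "internal_direct_sum M (carrier M) (C <+>\<^bsub>M\<^esub> A') B'"
    using right_submoduleD(2)[OF CA'] right_submoduleD(2)[OF B'(1)]
    by (auto simp: internal_direct_sum_def)
  show ?thesis using that A' B' 1 2 by blast
qed

end

section \<open>Direct sums of relatively ojective CLS-modules\<close>

theorem theorem3p2:
  fixes R :: "('a, 'r) ring_scheme"
    and M :: "('a, 'm, 'z) rmodule_scheme"
    and M\<^sub>1 M\<^sub>2 :: "'m set"
  assumes "right_module R M"
    and "right_submodule R M M\<^sub>1"
    and "right_submodule R M M\<^sub>2"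
    and "internal_direct_sum M (carrier M) M\<^sub>1 M\<^sub>2"
    and "CLS_module R (restrict_module M M\<^sub>1)"
    and "CLS_module R (restrict_module M M\<^sub>2)"
    and "relatively_ojective R (restrict_module M M\<^sub>1) (restrict_module M M\<^sub>2)"
  shows "CLS_module R M"
  unfolding CLS_module_def
proof (intro conjI allI impI)
  show "right_module R M" by fact
  interpret right_module R M by fact
  note M1 = assms(2) and M2 = assms(3)
  interpret M1: right_module R "restrict_module M M\<^sub>1" by (rule restrict_right_module[OF M1])
  interpret M2: right_module R "restrict_module M M\<^sub>2" by (rule restrict_right_module[OF M2])
  note c1 = subsetD[OF right_submoduleD(1)[OF M1]] and c2 = subsetD[OF right_submoduleD(1)[OF M2]]
  note uniq = internal_direct_sum_unique[OF M1 M2 assms(4)]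
  have split: "\<exists>x\<in>M\<^sub>1. \<exists>y\<in>M\<^sub>2. m = x \<oplus>\<^bsub>M\<^esub> y" if "m \<in> carrier M" for m
    using that assms(4) unfolding internal_direct_sum_def mem_set_add_iff[symmetric] by blast
  fix N assume "S_closed R M N"
  then have N: "right_submodule R M N"
    and Ncl: "\<And>m I. \<lbrakk>m \<in> carrier M; essential_right_ideal R I; \<And>a. a \<in> I \<Longrightarrow> m \<odot>\<^sub>r\<^bsub>M\<^esub> a \<in> N\<rbrakk> \<Longrightarrow> m \<in> N"
    unfolding S_closed_iff by blast+
  note cN = subsetD[OF right_submoduleD(1)[OF N]]

  \<comment> \<open>The part of \<open>N\<close> inside \<open>M\<^sub>2\<close> is split off, since a complement of \<open>M\<^sub>2\<close> meets \<open>M\<^sub>2\<close> in \<open>0\<close>.\<close>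
  have "S_closed R (restrict_module M M\<^sub>2) (N \<inter> M\<^sub>2)"
    unfolding M2.S_closed_iff right_submodule_restrict_iff[OF M2]
    using right_submodule_Int[OF N M2] Ncl c2 by (simp; blast)
  then have "direct_summand R (restrict_module M M\<^sub>2) (N \<inter> M\<^sub>2)"
    using assms(6) unfolding CLS_module_def by blast
  then obtain E\<^sub>2 where E2: "right_submodule R M E\<^sub>2" "E\<^sub>2 \<subseteq> M\<^sub>2"
    and NE2: "internal_direct_sum M M\<^sub>2 (N \<inter> M\<^sub>2) E\<^sub>2"
    by (rule direct_summand_restrictE[OF M2])

  \<comment> \<open>In the notation below, \<open>M = (N \<inter> M\<^sub>2) \<oplus> P\<close> and, by modularity, \<open>N = (N \<inter> M\<^sub>2) \<oplus> K\<close>.\<close>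
  define P where "P = M\<^sub>1 <+>\<^bsub>M\<^esub> E\<^sub>2"
  have P: "right_submodule R M P"
    unfolding P_def by (rule right_submodule_set_add[OF M1 E2(1)])
  define K where "K = N \<inter> P"
  have K: "right_submodule R M K"
    unfolding K_def by (rule right_submodule_Int[OF N P])
  note cK = subsetD[OF right_submoduleD(1)[OF K]]
  have K_M2: "k = \<zero>\<^bsub>M\<^esub>" if k: "k \<in> K" "k \<in> M\<^sub>2" for k
  proof -
    obtain x e where xe: "x \<in> M\<^sub>1" "e \<in> E\<^sub>2" "k = x \<oplus>\<^bsub>M\<^esub> e"
      using k(1) unfolding K_def P_def Int_iff mem_set_add_iff by blast
    have "x \<oplus>\<^bsub>M\<^esub> e = \<zero>\<^bsub>M\<^esub> \<oplus>\<^bsub>M\<^esub> k"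
      unfolding M.l_zero[OF c2[OF k(2)]] by (rule xe(3)[symmetric])
    then have "e = k"
      using uniq(2) xe(1,2) E2(2) k(2) right_submoduleD(2)[OF M1] by blast
    then show ?thesis
      using NE2 k xe(2) unfolding internal_direct_sum_def K_def by blast
  qed
  have decomp: "\<exists>n\<in>N \<inter> M\<^sub>2. \<exists>p\<in>P. m = n \<oplus>\<^bsub>M\<^esub> p" if "m \<in> carrier M" for m
  proof -
    obtain x y where xy: "x \<in> M\<^sub>1" "y \<in> M\<^sub>2" "m = x \<oplus>\<^bsub>M\<^esub> y" using split \<open>m \<in> carrier M\<close> by blast
    have "y \<in> (N \<inter> M\<^sub>2) <+>\<^bsub>M\<^esub> E\<^sub>2"
      using xy(2) NE2 unfolding internal_direct_sum_def by simp
    then obtain n e where ne: "n \<in> N \<inter> M\<^sub>2" "e \<in> E\<^sub>2" "y = n \<oplus>\<^bsub>M\<^esub> e"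
      unfolding mem_set_add_iff by blast
    have "m = n \<oplus>\<^bsub>M\<^esub> (x \<oplus>\<^bsub>M\<^esub> e)"
      unfolding xy(3) ne(3) using xy(1) ne(1,2) c1 c2 E2(2) by (intro M.a_lcomm) auto
    moreover have "x \<oplus>\<^bsub>M\<^esub> e \<in> P"
      unfolding P_def mem_set_add_iff using xy(1) ne(2) by blast
    ultimately show ?thesis using ne(1) by blast
  qed
  have decomp_N: "\<exists>n\<in>N \<inter> M\<^sub>2. \<exists>k\<in>K. m = n \<oplus>\<^bsub>M\<^esub> k" if m: "m \<in> N" for m
  proof -
    obtain n p where np: "n \<in> N \<inter> M\<^sub>2" "p \<in> P" "m = n \<oplus>\<^bsub>M\<^esub> p" using decomp cN[OF m] by blast
    then have "p \<in> N"
      using right_submodule_add_cancel[OF N, of n p] m cN right_submoduleD(1)[OF P] by blast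
    then show ?thesis using np unfolding K_def by blast
  qed

  \<comment> \<open>\<open>X\<close> is the projection of \<open>K\<close> to \<open>M\<^sub>1\<close>; it is also that of \<open>N\<close>,
      because \<open>N\<close> and \<open>K\<close> differ by elements of \<open>M\<^sub>2\<close>.\<close>
  define X where "X = {x \<in> M\<^sub>1. \<exists>y\<in>M\<^sub>2. x \<oplus>\<^bsub>M\<^esub> y \<in> K}"
  have X_N: "x \<in> X" if xy: "x \<in> M\<^sub>1" "y \<in> M\<^sub>2" "x \<oplus>\<^bsub>M\<^esub> y \<in> N" for x y
  proof -
    obtain n k where nk: "n \<in> N \<inter> M\<^sub>2" "k \<in> K" "x \<oplus>\<^bsub>M\<^esub> y = n \<oplus>\<^bsub>M\<^esub> k"
      using decomp_N[OF xy(3)] by blast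
    obtain x' y' where x'y': "x' \<in> M\<^sub>1" "y' \<in> M\<^sub>2" "k = x' \<oplus>\<^bsub>M\<^esub> y'"
      using split[OF cK[OF nk(2)]] by blast
    have "x \<oplus>\<^bsub>M\<^esub> y = x' \<oplus>\<^bsub>M\<^esub> (n \<oplus>\<^bsub>M\<^esub> y')"
      unfolding nk(3) x'y'(3) using x'y'(1,2) nk(1) c1 c2 by (intro M.a_lcomm) auto
    then have "x = x'"
      using uniq(1) xy x'y' nk(1) right_submoduleD(3)[OF M2] by blast
    then show ?thesis using x'y' nk(2) unfolding X_def by blast
  qed
  have X: "right_submodule R M X" "X \<subseteq> M\<^sub>1"
    unfolding X_def using right_submodule_projection[OF M1 M2 K] by blast+
  have X1: "right_submodule R (restrict_module M M\<^sub>1) X"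
    using X by (simp add: right_submodule_restrict_iff[OF M1])

  \<comment> \<open>\<open>X\<close> itself need not be a summand of \<open>M\<^sub>1\<close>; its singular closure \<open>L\<close> is one, because
      \<open>X\<close> contains every singular element of \<open>M\<^sub>1\<close>.\<close>
  define L where "L = singular_closure R (restrict_module M M\<^sub>1) X"
  have "singular_submodule R (restrict_module M M\<^sub>1) \<subseteq> X"
  proof
    fix m assume "m \<in> singular_submodule R (restrict_module M M\<^sub>1)"
    then obtain I where m: "m \<in> M\<^sub>1" and I: "essential_right_ideal R I"
      "\<And>a. a \<in> I \<Longrightarrow> m \<odot>\<^sub>r\<^bsub>M\<^esub> a = \<zero>\<^bsub>M\<^esub>"
      unfolding singular_submodule_def by auto
    have "m \<in> N"
      using Ncl[OF c1[OF m] I(1)] I(2) right_submoduleD(2)[OF N] by simp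
    then show "m \<in> X"
      using X_N[OF m right_submoduleD(2)[OF M2]] c1[OF m] by simp
  qed
  then have "S_closed R (restrict_module M M\<^sub>1) L"
    unfolding L_def by (rule M1.S_closed_singular_closure[OF X1])
  then have "direct_summand R (restrict_module M M\<^sub>1) L" and L: "right_submodule R M L" "L \<subseteq> M\<^sub>1"
    using assms(5) unfolding CLS_module_def S_closed_def right_submodule_restrict_iff[OF M1] by auto
  then obtain E\<^sub>1 where E1: "right_submodule R M E\<^sub>1" "E\<^sub>1 \<subseteq> M\<^sub>1"
    and LE1: "internal_direct_sum M M\<^sub>1 L E\<^sub>1"
    using direct_summand_restrictE[OF M1] by metis
  have X_L: "X \<subseteq> L"
    unfolding L_def by (rule M1.singular_closure_superset[OF X1])
  have LE1_0: "L \<inter> E\<^sub>1 = {\<zero>\<^bsub>M\<^esub>}"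
    using LE1 unfolding internal_direct_sum_def by blast
  have K_L: "x \<in> L" if "x \<in> M\<^sub>1" "y \<in> M\<^sub>2" "x \<oplus>\<^bsub>M\<^esub> y \<in> K" for x y
    using that X_L unfolding X_def by blast

  \<comment> \<open>Enlarging \<open>K\<close> by \<open>E\<^sub>1\<close> fills the part of \<open>M\<^sub>1\<close> that \<open>L\<close> leaves free.  The two steps
      below, trivial intersection with \<open>M\<^sub>2\<close> and maximality, make \<open>C\<close> a complement of \<open>M\<^sub>2\<close>.\<close>
  define C where "C = K <+>\<^bsub>M\<^esub> E\<^sub>1"
  have C: "right_submodule R M C"
    unfolding C_def by (rule right_submodule_set_add[OF K E1(1)])
  have K_C: "K \<subseteq> C" and E1_C: "E\<^sub>1 \<subseteq> C"
  proof -
    have "k \<in> C" if "k \<in> K" for k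
      using that right_submoduleD(2)[OF E1(1)] M.r_zero[OF cK[OF that]]
      unfolding C_def mem_set_add_iff by metis
    moreover have "e \<in> C" if "e \<in> E\<^sub>1" for e
      using that right_submoduleD(2)[OF K] M.l_zero c1 E1(2)
      unfolding C_def mem_set_add_iff by (metis subsetD)
    ultimately show "K \<subseteq> C" "E\<^sub>1 \<subseteq> C" by blast+
  qed
  have C_M2: "c = \<zero>\<^bsub>M\<^esub>" if c: "c \<in> C" "c \<in> M\<^sub>2" for c
  proof -
    obtain k e where ke: "k \<in> K" "e \<in> E\<^sub>1" "c = k \<oplus>\<^bsub>M\<^esub> e"
      using c(1) unfolding C_def mem_set_add_iff by blast
    obtain x y where xy: "x \<in> M\<^sub>1" "y \<in> M\<^sub>2" "k = x \<oplus>\<^bsub>M\<^esub> y"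
      using split[OF cK[OF ke(1)]] by blast
    have e1: "e \<in> M\<^sub>1" using ke(2) E1(2) by blast
    have "(x \<oplus>\<^bsub>M\<^esub> e) \<oplus>\<^bsub>M\<^esub> y = c"
      unfolding ke(3) xy(3) using xy(1,2) e1 c1 c2 by (simp add: M.a_ac)
    also have "c = \<zero>\<^bsub>M\<^esub> \<oplus>\<^bsub>M\<^esub> c"
      using c2[OF c(2)] by simp
    finally have "x \<oplus>\<^bsub>M\<^esub> e = \<zero>\<^bsub>M\<^esub>"
      using uniq(1) right_submoduleD(3)[OF M1 xy(1) e1] right_submoduleD(2)[OF M1] xy(2) c(2) by blast
    moreover have x: "x \<in> L"
      using K_L xy ke(1) by blast
    ultimately have "e \<in> L"
      using right_submodule_add_cancel[OF L(1), of x e] right_submoduleD(2)[OF L(1)] c1 xy(1) e1 by auto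
    then have "e = \<zero>\<^bsub>M\<^esub>" using LE1_0 ke(2) by blast
    then have "c = k" using ke(3) cK[OF ke(1)] by simp
    then show ?thesis using K_M2 ke(1) c(2) by blast
  qed
  have C_max: "D = C" if D: "right_submodule R M D" "D \<inter> M\<^sub>2 = {\<zero>\<^bsub>M\<^esub>}" "C \<subseteq> D" for D
  proof -
    note cD = subsetD[OF right_submoduleD(1)[OF D(1)]]
    \<comment> \<open>The heart of maximality: multiplying \<open>d\<close> by \<open>a\<close> in the essential right ideal \<open>?I\<close> moves its
        \<open>M\<^sub>1\<close>-component into \<open>X\<close>, so \<open>d a\<close> agrees with an element of \<open>K\<close> up to an element of
        \<open>D \<inter> M\<^sub>2 = 0\<close>.  Hence \<open>d ?I \<subseteq> N\<close>, and \<open>d \<in> N\<close> because \<open>M/N\<close> is nonsingular.\<close>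
    have D_L: "d \<in> K" if d: "d \<in> D" and l: "l \<in> L" "y \<in> M\<^sub>2" "d = l \<oplus>\<^bsub>M\<^esub> y" for d l y
    proof -
      let ?I = "{r \<in> carrier R. l \<odot>\<^sub>r\<^bsub>M\<^esub> r \<in> X}"
      have l1: "l \<in> M\<^sub>1" using l(1) L(2) by blast
      have "d \<odot>\<^sub>r\<^bsub>M\<^esub> a \<in> N" if "a \<in> ?I" for a
      proof -
        have a: "a \<in> carrier R" using that by blast
        obtain z where z: "z \<in> M\<^sub>2" "l \<odot>\<^sub>r\<^bsub>M\<^esub> a \<oplus>\<^bsub>M\<^esub> z \<in> K" and la: "l \<odot>\<^sub>r\<^bsub>M\<^esub> a \<in> M\<^sub>1"
          using \<open>a \<in> ?I\<close> unfolding X_def by blast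
        have ya: "y \<odot>\<^sub>r\<^bsub>M\<^esub> a \<in> M\<^sub>2" by (rule right_submoduleD(4)[OF M2 l(2) a])
        have da: "d \<odot>\<^sub>r\<^bsub>M\<^esub> a = l \<odot>\<^sub>r\<^bsub>M\<^esub> a \<oplus>\<^bsub>M\<^esub> y \<odot>\<^sub>r\<^bsub>M\<^esub> a"
          unfolding l(3) by (rule rsmult_add_left[OF c1[OF l1] c2[OF l(2)] a])
        have "(y \<odot>\<^sub>r\<^bsub>M\<^esub> a \<ominus>\<^bsub>M\<^esub> z) \<oplus>\<^bsub>M\<^esub> (l \<odot>\<^sub>r\<^bsub>M\<^esub> a \<oplus>\<^bsub>M\<^esub> z)
            = l \<odot>\<^sub>r\<^bsub>M\<^esub> a \<oplus>\<^bsub>M\<^esub> ((y \<odot>\<^sub>r\<^bsub>M\<^esub> a \<ominus>\<^bsub>M\<^esub> z) \<oplus>\<^bsub>M\<^esub> z)"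
          using c1[OF la] c2[OF ya] c2[OF z(1)] by (intro M.a_lcomm) auto
        also have "\<dots> = d \<odot>\<^sub>r\<^bsub>M\<^esub> a"
          unfolding da using c2[OF ya] c2[OF z(1)] by (simp add: minus_add_cancel)
        finally have eq: "(y \<odot>\<^sub>r\<^bsub>M\<^esub> a \<ominus>\<^bsub>M\<^esub> z) \<oplus>\<^bsub>M\<^esub> (l \<odot>\<^sub>r\<^bsub>M\<^esub> a \<oplus>\<^bsub>M\<^esub> z) = d \<odot>\<^sub>r\<^bsub>M\<^esub> a" .
        have yz: "y \<odot>\<^sub>r\<^bsub>M\<^esub> a \<ominus>\<^bsub>M\<^esub> z \<in> M\<^sub>2" by (rule right_submodule_minus[OF M2 ya z(1)])
        have "d \<odot>\<^sub>r\<^bsub>M\<^esub> a \<in> D" by (rule right_submoduleD(4)[OF D(1) d a])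
        moreover have "l \<odot>\<^sub>r\<^bsub>M\<^esub> a \<oplus>\<^bsub>M\<^esub> z \<in> D" using z(2) K_C D(3) by blast
        ultimately have "y \<odot>\<^sub>r\<^bsub>M\<^esub> a \<ominus>\<^bsub>M\<^esub> z \<in> D"
          using right_submodule_add_cancel[OF D(1) _ c2[OF yz] cK[OF z(2)]] unfolding eq by blast
        then have "y \<odot>\<^sub>r\<^bsub>M\<^esub> a \<ominus>\<^bsub>M\<^esub> z = \<zero>\<^bsub>M\<^esub>" using yz D(2) by blast
        then have "d \<odot>\<^sub>r\<^bsub>M\<^esub> a = l \<odot>\<^sub>r\<^bsub>M\<^esub> a \<oplus>\<^bsub>M\<^esub> z"
          using eq cK[OF z(2)] by simp
        then show ?thesis using z(2) unfolding K_def by simp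
      qed
      moreover have "essential_right_ideal R ?I"
        using l(1) unfolding L_def singular_closure_def by simp
      ultimately have "d \<in> N" using Ncl cD[OF d] by blast
      then obtain n k where nk: "n \<in> N \<inter> M\<^sub>2" "k \<in> K" "d = n \<oplus>\<^bsub>M\<^esub> k"
        using decomp_N by blast
      have "k \<in> D" using nk(2) K_C D(3) by blast
      then have "n \<in> D"
        using right_submodule_add_cancel[OF D(1), of n k] d nk cN cK by blast
      then have "n = \<zero>\<^bsub>M\<^esub>" using nk(1) D(2) by blast
      then show ?thesis using nk cK by simp
    qed
    \<comment> \<open>Subtracting the \<open>E\<^sub>1\<close>-component of \<open>d\<close>, an element of \<open>C \<subseteq> D\<close>, reduces to the case above.\<close>
    have "d \<in> C" if d: "d \<in> D" for d
    proof -
      obtain x y where xy: "x \<in> M\<^sub>1" "y \<in> M\<^sub>2" "d = x \<oplus>\<^bsub>M\<^esub> y" using split[OF cD[OF d]] by blast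
      have "x \<in> L <+>\<^bsub>M\<^esub> E\<^sub>1" using xy(1) LE1 unfolding internal_direct_sum_def by simp
      then obtain l e where le: "l \<in> L" "e \<in> E\<^sub>1" "x = l \<oplus>\<^bsub>M\<^esub> e"
        unfolding mem_set_add_iff by blast
      have lc: "l \<in> carrier M" "e \<in> carrier M" "y \<in> carrier M"
        using le(1,2) xy(2) L(2) E1(2) c1 c2 by blast+
      have deq: "d = (l \<oplus>\<^bsub>M\<^esub> y) \<oplus>\<^bsub>M\<^esub> e"
        unfolding xy(3) le(3) using lc by (simp add: M.a_ac)
      have "e \<in> D" using le(2) E1_C D(3) by blast
      then have "l \<oplus>\<^bsub>M\<^esub> y \<in> D"
        using right_submodule_add_cancel[OF D(1), of "l \<oplus>\<^bsub>M\<^esub> y" e] d lc unfolding deq by blast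
      then have "l \<oplus>\<^bsub>M\<^esub> y \<in> K" using D_L le(1) xy(2) by blast
      then show ?thesis
        unfolding deq C_def mem_set_add_iff using le(2) by blast
    qed
    with D(3) show "D = C" by blast
  qed
  have "C \<inter> M\<^sub>2 = {\<zero>\<^bsub>M\<^esub>}"
    using C_M2 right_submoduleD(2)[OF C] right_submoduleD(2)[OF M2] by blast
  then have C_compl: "complement_of R M M\<^sub>2 C"
    unfolding complement_of_def using C C_max by simp
  have "ojective R (restrict_module M M\<^sub>1) (restrict_module M M\<^sub>2)"
    using assms(7) by (simp add: relatively_ojective_def)
  from ojective_complement_decomposition[OF M1 M2 assms(4) this C_compl]
  obtain A' B' where A': "right_submodule R M A'" and B': "right_submodule R M B'"
    and CA': "internal_direct_sum M (C <+>\<^bsub>M\<^esub> A') C A'"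
    and CAB': "internal_direct_sum M (carrier M) (C <+>\<^bsub>M\<^esub> A') B'"
    by metis

  \<comment> \<open>Ojectivity makes \<open>C = K \<oplus> E\<^sub>1\<close> a summand, hence \<open>M = K \<oplus> Y\<close>.\<close>
  define Y where "Y = (E\<^sub>1 <+>\<^bsub>M\<^esub> A') <+>\<^bsub>M\<^esub> B'"
  have Y: "right_submodule R M Y"
    unfolding Y_def by (intro right_submodule_set_add E1(1) A' B')
  note cE1 = subsetD[OF right_submoduleD(1)[OF E1(1)]]
    and cA' = subsetD[OF right_submoduleD(1)[OF A']]
    and cB' = subsetD[OF right_submoduleD(1)[OF B']]
  have K_Y: "k = \<zero>\<^bsub>M\<^esub>" if k: "k \<in> K" "k \<in> Y" for k
  proof -
    obtain e a b where eab: "e \<in> E\<^sub>1" "a \<in> A'" "b \<in> B'" "k = (e \<oplus>\<^bsub>M\<^esub> a) \<oplus>\<^bsub>M\<^esub> b"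
      using k(2) unfolding Y_def set_add_def' by blast
    note CA's = right_submodule_set_add[OF C A']
    have kC: "k \<in> C" and eC: "e \<in> C" using k(1) eab(1) K_C E1_C by blast+
    have "k \<oplus>\<^bsub>M\<^esub> \<zero>\<^bsub>M\<^esub> \<in> C <+>\<^bsub>M\<^esub> A'" "e \<oplus>\<^bsub>M\<^esub> a \<in> C <+>\<^bsub>M\<^esub> A'"
      unfolding mem_set_add_iff using kC eC eab(2) right_submoduleD(2)[OF A'] by blast+
    moreover have "(e \<oplus>\<^bsub>M\<^esub> a) \<oplus>\<^bsub>M\<^esub> b = (k \<oplus>\<^bsub>M\<^esub> \<zero>\<^bsub>M\<^esub>) \<oplus>\<^bsub>M\<^esub> \<zero>\<^bsub>M\<^esub>"
      using eab(4) cK[OF k(1)] by simp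
    ultimately have "e \<oplus>\<^bsub>M\<^esub> a = k \<oplus>\<^bsub>M\<^esub> \<zero>\<^bsub>M\<^esub>"
      using internal_direct_sum_unique(1)[OF CA's B' CAB'] eab(3) right_submoduleD(2)[OF B'] by blast
    then have "e = k"
      using internal_direct_sum_unique(1)[OF C A' CA'] eC kC eab(2) right_submoduleD(2)[OF A'] by blast
    then have k1: "k \<in> M\<^sub>1" "k \<in> E\<^sub>1" using eab(1) E1(2) by blast+
    then have "k \<in> L"
      using K_L[OF k1(1) right_submoduleD(2)[OF M2]] k(1) c1 by simp
    then show ?thesis using LE1_0 k1(2) by blast
  qed
  have K_Y_sum: "\<exists>k\<in>K. \<exists>y\<in>Y. m = k \<oplus>\<^bsub>M\<^esub> y" if m: "m \<in> carrier M" for m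
  proof -
    have "m \<in> ((K <+>\<^bsub>M\<^esub> E\<^sub>1) <+>\<^bsub>M\<^esub> A') <+>\<^bsub>M\<^esub> B'"
      using CAB' m unfolding internal_direct_sum_def C_def by simp
    then obtain k e a b where h: "k \<in> K" "e \<in> E\<^sub>1" "a \<in> A'" "b \<in> B'"
      "m = ((k \<oplus>\<^bsub>M\<^esub> e) \<oplus>\<^bsub>M\<^esub> a) \<oplus>\<^bsub>M\<^esub> b"
      unfolding set_add_def' by blast
    then have "m = k \<oplus>\<^bsub>M\<^esub> ((e \<oplus>\<^bsub>M\<^esub> a) \<oplus>\<^bsub>M\<^esub> b)"
      using cK cE1 cA' cB' by (simp add: M.a_assoc)
    then show ?thesis
      using h unfolding Y_def set_add_def' by blast
  qed

  \<comment> \<open>Since \<open>K \<subseteq> P\<close>, modularity gives \<open>P = K \<oplus> (P \<inter> Y)\<close>, so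
      \<open>M = (N \<inter> M\<^sub>2) \<oplus> K \<oplus> (P \<inter> Y) = N \<oplus> (P \<inter> Y)\<close>.\<close>
  have PY: "right_submodule R M (P \<inter> Y)"
    by (rule right_submodule_Int[OF P Y])
  have "carrier M \<subseteq> N <+>\<^bsub>M\<^esub> (P \<inter> Y)"
  proof
    fix m assume "m \<in> carrier M"
    then obtain n p where np: "n \<in> N \<inter> M\<^sub>2" "p \<in> P" "m = n \<oplus>\<^bsub>M\<^esub> p" using decomp by blast
    have pc: "p \<in> carrier M" using np(2) right_submoduleD(1)[OF P] by blast
    obtain k y where ky: "k \<in> K" "y \<in> Y" "p = k \<oplus>\<^bsub>M\<^esub> y" using K_Y_sum[OF pc] by blast
    have yc: "y \<in> carrier M" using ky(2) right_submoduleD(1)[OF Y] by blast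
    have kN: "k \<in> N" "k \<in> P" using ky(1) unfolding K_def by blast+
    have "y \<in> P"
      using right_submodule_add_cancel[OF P, of k y] np(2) kN(2) cK[OF ky(1)] yc unfolding ky(3) by blast
    moreover have "m = (n \<oplus>\<^bsub>M\<^esub> k) \<oplus>\<^bsub>M\<^esub> y"
      unfolding np(3) ky(3) using np(1) cN cK[OF ky(1)] yc by (simp add: M.a_assoc)
    moreover have "n \<oplus>\<^bsub>M\<^esub> k \<in> N" using right_submoduleD(3)[OF N] np(1) kN(1) by blast
    ultimately show "m \<in> N <+>\<^bsub>M\<^esub> (P \<inter> Y)"
      using ky(2) unfolding mem_set_add_iff by blast
  qed
  moreover have "N <+>\<^bsub>M\<^esub> (P \<inter> Y) \<subseteq> carrier M"
    by (rule right_submoduleD(1)[OF right_submodule_set_add[OF N PY]])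
  moreover have "N \<inter> (P \<inter> Y) = {\<zero>\<^bsub>M\<^esub>}"
    using K_Y right_submoduleD(2)[OF N] right_submoduleD(2)[OF PY] unfolding K_def by blast
  ultimately have "internal_direct_sum M (carrier M) N (P \<inter> Y)"
    unfolding internal_direct_sum_def by blast
  then show "direct_summand R M N"
    unfolding direct_summand_def using N PY by blast
qed

end
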